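(* For every integer $n\ge 14$, there exists a graph $G_n=(V,E)$ with $n$ vertices and $6n-15$ edges, an injective map $\phi:V\to\mathbb{R}^3$, two of the three coordinate planes of $\mathbb{R}^3$, and a decomposition $E=E_1\cup E_2$, such that the projections of $\phi$ onto these two planes are injective on $V$ and, with edges drawn as straight-line segments between projected endpoints, are planar straight-line embeddings of $(V,E_1)$ and $(V,E_2)$ respectively (so the edge-union of the two planar graphs is $G_n$).
   Context: The coordinate planes of $\mathbb{R}^3$ are the $XY$, $YZ$ and $ZX$ planes; projection onto the $XY$ plane maps $(x,y,z)\mapsto(x,y)$, and similarly for the others. *)

theory Defs
  imports "HOL-Analysis.Analysis"
begin

text \<open>Finite simple graphs; an edge is the two-element set of its endpoints.\<close>

definition simple_graph :: "'v set \<Rightarrow> 'v set set \<Rightarrow> bool" where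
  "simple_graph V E \<longleftrightarrow> finite V \<and> (\<forall>e\<in>E. e \<subseteq> V \<and> card e = 2)"

datatype coord_plane = XY | YZ | ZX

fun coord_proj :: "coord_plane \<Rightarrow> real^3 \<Rightarrow> real^2" where
  "coord_proj XY p = vector [p $ 1, p $ 2]"
| "coord_proj YZ p = vector [p $ 2, p $ 3]"
| "coord_proj ZX p = vector [p $ 3, p $ 1]"

text \<open>Distinct vertices are placed at distinct points, no vertex lies in the relative interior
  of an edge, and the relative interiors of distinct edges are disjoint.\<close>

definition planar_straight_line_embedding ::
    "'v set \<Rightarrow> 'v set set \<Rightarrow> ('v \<Rightarrow> real^2) \<Rightarrow> bool" where
  "planar_straight_line_embedding V E p \<longleftrightarrow>
     inj_on p V \<and>
     (\<forall>u v. {u, v} \<in> E \<longrightarrow> p ` V \<inter> open_segment (p u) (p v) = {}) \<and>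
     (\<forall>u v x y. {u, v} \<in> E \<longrightarrow> {x, y} \<in> E \<longrightarrow> {u, v} \<noteq> {x, y} \<longrightarrow>
        open_segment (p u) (p v) \<inter> open_segment (p x) (p y) = {})"

end

theory Submission
  imports Defs
begin

text \<open>The \<open>XY\<close> and \<open>ZX\<close> planes share the coordinate \<open>x\<close>, while \<open>y\<close> and \<open>z\<close> are independent.
  Hence it suffices to give two edge-disjoint straight-line drawings on the same vertices in which
  each vertex has the same \<open>x\<close> in both. Placing a new vertex, with a common \<open>x\<close>, inside an empty
  triangle of each drawing and joining it to the corners adds six edges, and these are distinct if
  the two triangles have no common corner. Starting from an explicit drawing with 12 vertices and
  57 edges, this step can be repeated forever: all new vertices have \<open>x = 0\<close>, and a triangle
  \<open>a b c\<close> whose side \<open>a b\<close> crosses the line \<open>x = 0\<close> is replaced by \<open>a b v\<close> after \<open>v\<close> has been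
  inserted into it.\<close>

section \<open>Oriented triangles\<close>

text \<open>Twice the signed area of the triangle \<open>a b c\<close>: positive exactly for a
  counterclockwise triangle, zero for collinear points.\<close>

definition orient :: "real^2 \<Rightarrow> real^2 \<Rightarrow> real^2 \<Rightarrow> real" where
  "orient a b c = (b$1 - a$1) * (c$2 - a$2) - (b$2 - a$2) * (c$1 - a$1)"

text \<open>Intersection of the open half-planes to the left of the three sides. By
  \<open>orient_sum\<close> it is empty unless \<open>a b c\<close> is counterclockwise.\<close>

definition open_triangle :: "real^2 \<Rightarrow> real^2 \<Rightarrow> real^2 \<Rightarrow> (real^2) set" where
  "open_triangle a b c = {q. 0 < orient a b q \<and> 0 < orient b c q \<and> 0 < orient c a q}"

lemma orient_degenerate [simp]: "orient a a b = 0" "orient a b a = 0" "orient a b b = 0"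
  by (simp_all add: orient_def)

lemma orient_rotate: "orient b c a = orient a b c"
  by (simp add: orient_def algebra_simps)

lemma orient_sum: "orient a b q + orient b c q + orient c a q = orient a b c"
  by (simp add: orient_def algebra_simps)

lemma orient_affine:
  "orient a b ((1 - t) *\<^sub>R p + t *\<^sub>R q) = (1 - t) * orient a b p + t * orient a b q"
  by (simp add: orient_def algebra_simps)

text \<open>The parameter \<open>t\<close> is the same for all lines \<open>a b\<close>, so the
  position of \<open>x\<close> relative to several lines can be compared at once.\<close>

lemma open_segment_orient:
  assumes "x \<in> open_segment p q"
  obtains t where "0 < t" "t < 1"
    and "\<And>a b. orient a b x = (1 - t) * orient a b p + t * orient a b q"
  using assms by (auto simp: in_segment orient_affine)

lemma open_triangle_orient_pos:
  assumes "q \<in> open_triangle a b c"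
  shows "0 < orient a b c"
  using assms orient_sum[of a b q c] by (auto simp: open_triangle_def)

lemma open_triangle_meets_axis:
  assumes "0 < orient a b c" "a $ i < 0" "0 < b $ i"
  shows "\<exists>q \<in> open_triangle a b c. q $ i = 0"
proof -
  \<comment> \<open>Weights \<open>u\<close>, \<open>v\<close>, 1 on \<open>a\<close>,
    \<open>b\<close>, \<open>c\<close> balance the coordinate: \<open>u * a $ i\<close> is
    \<open>- (\<bar>c $ i\<bar> + 1)\<close> and \<open>v * b $ i\<close> is
    \<open>\<bar>c $ i\<bar> + 1 - c $ i\<close>. The summand 1 keeps both weights positive;
    division by \<open>N\<close> makes them barycentric.\<close>
  define u where "u = (\<bar>c $ i\<bar> + 1) / (- a $ i)"
  define v where "v = (\<bar>c $ i\<bar> + 1 - c $ i) / b $ i"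
  define N where "N = u + v + 1"
  have u: "u > 0" and v: "v > 0"
    using assms by (auto simp: u_def v_def intro!: divide_pos_pos divide_pos_neg)
  hence N: "N > 0" by (simp add: N_def)
  have uv: "u * a $ i + v * b $ i + c $ i = 0"
    using assms by (simp add: u_def v_def)
  define r s t where "r = u / N" and "s = v / N" and "t = 1 / N"
  have pos: "0 < r" "0 < s" "0 < t"
    using u v N by (simp_all add: r_def s_def t_def)
  have "r + s + t = (u + v + 1) / N"
    by (simp add: r_def s_def t_def add_divide_distrib)
  hence r: "r = 1 - s - t"
    using N by (simp add: N_def[symmetric])
  define q where "q = r *\<^sub>R a + s *\<^sub>R b + t *\<^sub>R c"
  have "q $ i = (u * a $ i + v * b $ i + c $ i) / N"
    by (simp add: q_def r_def s_def t_def add_divide_distrib)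
  hence "q $ i = 0" using uv by simp
  moreover have "orient a b q = t * orient a b c" "orient b c q = r * orient a b c"
    "orient c a q = s * orient a b c"
    by (simp_all add: q_def r orient_def algebra_simps)
  ultimately show ?thesis
    using pos assms(1) by (intro bexI[of _ q]) (simp_all add: open_triangle_def)
qed

text \<open>For each side, the orientation is positive at \<open>q\<close> and nonnegative at a
  corner, hence positive strictly between them.\<close>

lemma open_segment_subset_open_triangle:
  assumes "q \<in> open_triangle a b c" "s \<in> {a, b, c}"
  shows "open_segment q s \<subseteq> open_triangle a b c"
proof
  fix x assume "x \<in> open_segment q s"
  then obtain t where t: "0 < t" "t < 1"
    and x: "\<And>a b. orient a b x = (1 - t) * orient a b q + t * orient a b s"
    by (metis open_segment_orient)
  have *: "0 < (1 - t) * y + t * z" if "0 < y" "0 \<le> z" for y z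
    using t that by (simp add: add_pos_nonneg)
  have "0 \<le> orient a b s" "0 \<le> orient b c s" "0 \<le> orient c a s"
    using assms(2) open_triangle_orient_pos[OF assms(1)] orient_rotate[of a b c] orient_rotate[of b c a]
    by auto
  thus "x \<in> open_triangle a b c"
    using assms(1) by (simp add: open_triangle_def x *)
qed

lemma open_segments_from_point_disjoint:
  assumes "orient q s t \<noteq> 0"
  shows "open_segment q s \<inter> open_segment q t = {}"
proof (rule equals0I)
  fix x assume "x \<in> open_segment q s \<inter> open_segment q t"
  hence "x \<in> open_segment q s" "x \<in> open_segment q t" by auto
  then obtain k l where "0 < l"
    and "\<And>a b. orient a b x = (1 - k) * orient a b q + k * orient a b s"
    and "\<And>a b. orient a b x = (1 - l) * orient a b q + l * orient a b t"
    by (metis open_segment_orient)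
  from this(1) this(2,3)[of q s] show False using assms by simp
qed

lemma open_triangle_subdivide:
  assumes "q \<in> open_triangle a b c"
  shows "open_triangle a b q \<subseteq> open_triangle a b c"
    and "s \<in> {a, b, c} \<Longrightarrow> open_segment q s \<inter> open_triangle a b q = {}"
    and "q \<notin> open_triangle a b q"
proof -
  show "q \<notin> open_triangle a b q" by (simp add: open_triangle_def)
  have q: "0 < orient a b q" "0 < orient b c q" "0 < orient c a q"
    using assms by (auto simp: open_triangle_def)
  show "open_triangle a b q \<subseteq> open_triangle a b c"
  proof
    fix x assume "x \<in> open_triangle a b q"
    hence x: "0 < orient a b x" "0 < orient b q x" "0 < orient q a x"
      by (auto simp: open_triangle_def)
    \<comment> \<open>Three-term Pluecker relations for the determinants based at \<open>b\<close>
      and at \<open>a\<close>.\<close>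
    have "orient a b q * orient b c x = orient b q x * orient a b c + orient a b x * orient b c q"
      "orient a b q * orient c a x = orient q a x * orient a b c + orient a b x * orient c a q"
      by (simp_all add: orient_def algebra_simps)
    moreover have "0 < orient a b c" using open_triangle_orient_pos[OF assms] .
    ultimately have "0 < orient a b q * orient b c x" "0 < orient a b q * orient c a x"
      using x q by (simp_all add: add_pos_pos)
    thus "x \<in> open_triangle a b c"
      using q x by (simp add: open_triangle_def zero_less_mult_iff)
  qed
  show "open_segment q s \<inter> open_triangle a b q = {}" if s: "s \<in> {a, b, c}"
  proof (rule equals0I)
    fix x assume "x \<in> open_segment q s \<inter> open_triangle a b q"
    hence "x \<in> open_segment q s" and x: "0 < orient b q x" "0 < orient q a x"
      by (auto simp: open_triangle_def)
    then obtain t where t: "0 < t" and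
      xt: "\<And>a b. orient a b x = (1 - t) * orient a b q + t * orient a b s"
      by (metis open_segment_orient)
    \<comment> \<open>The corners \<open>a\<close> and \<open>b\<close> lie on the lines
      \<open>q a\<close> and \<open>b q\<close>; the corner \<open>c\<close> lies beyond the line
      \<open>b q\<close>.\<close>
    have "orient b q s \<le> 0 \<or> orient q a s \<le> 0"
      using s q by (auto simp: orient_def algebra_simps)
    thus False
      using x t by (auto simp: xt mult_less_0_iff zero_less_mult_iff)
  qed
qed

section \<open>Inserting a vertex into an empty triangle\<close>

text \<open>Only the interior is constrained, because an inserted vertex and its three open edges
  stay there.\<close>

definition empty_face :: "'v set \<Rightarrow> 'v set set \<Rightarrow> ('v \<Rightarrow> real^2) \<Rightarrow> 'v \<Rightarrow> 'v \<Rightarrow> 'v \<Rightarrow> bool" where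
  "empty_face V E p a b c \<longleftrightarrow>
     {a, b, c} \<subseteq> V \<and> 0 < orient (p a) (p b) (p c) \<and>
     p ` V \<inter> open_triangle (p a) (p b) (p c) = {} \<and>
     (\<forall>u v. {u, v} \<in> E \<longrightarrow> open_segment (p u) (p v) \<inter> open_triangle (p a) (p b) (p c) = {})"

context
  fixes V :: "'v set" and E p a b c w q
  assumes E: "\<And>e. e \<in> E \<Longrightarrow> e \<subseteq> V"
    and face: "empty_face V E p a b c"
    and w: "w \<notin> V"
    and q: "q \<in> open_triangle (p a) (p b) (p c)"
begin

lemma insert_vertex_image: "(p(w := q)) ` insert w V = insert q (p ` V)"
  using w by auto

text \<open>Reduces segments of the extended drawing to the old placement \<open>p\<close>: an old
  edge avoids \<open>w\<close>, so it does not move, and a new edge is a segment from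
  \<open>q\<close> to a corner.\<close>

lemma insert_vertex_edge_cases:
  assumes "{u, v} \<in> E \<union> {{w, a}, {w, b}, {w, c}}"
  obtains (old) "{u, v} \<in> E"
    "open_segment ((p(w := q)) u) ((p(w := q)) v) = open_segment (p u) (p v)"
  | (new) s where "s \<in> {a, b, c}" "{u, v} = {w, s}"
    "open_segment ((p(w := q)) u) ((p(w := q)) v) = open_segment q (p s)"
proof (cases "{u, v} \<in> E")
  case True
  with E w have "u \<noteq> w" "v \<noteq> w" by blast+
  thus ?thesis using True old by simp
next
  case False
  then obtain s where s: "s \<in> {a, b, c}" "{u, v} = {w, s}" using assms by auto
  have "s \<noteq> w" using s face w by (auto simp: empty_face_def)
  with s(2) have "open_segment ((p(w := q)) u) ((p(w := q)) v) = open_segment q (p s)"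
    by (auto simp: doubleton_eq_iff open_segment_commute)
  with s new show ?thesis by blast
qed

lemma insert_vertex_open_segment:
  assumes "s \<in> {a, b, c}"
  shows "open_segment q (p s) \<subseteq> open_triangle (p a) (p b) (p c)"
  by (rule open_segment_subset_open_triangle[OF q]) (use assms in auto)

text \<open>Old vertices and old edges avoid the open triangle while everything new lies inside it,
  so only pairs of new edges remain; these leave \<open>q\<close> in non-collinear
  directions.\<close>

lemma planar_insert_vertex:
  assumes "planar_straight_line_embedding V E p"
  shows "planar_straight_line_embedding (insert w V) (E \<union> {{w, a}, {w, b}, {w, c}}) (p(w := q))"
  unfolding planar_straight_line_embedding_def
proof (intro conjI allI impI)
  let ?p = "p(w := q)" and ?T = "open_triangle (p a) (p b) (p c)"
  have inj: "inj_on p V"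
    and vertex: "\<And>u v. {u, v} \<in> E \<Longrightarrow> p ` V \<inter> open_segment (p u) (p v) = {}"
    and cross: "\<And>u v x y. {u, v} \<in> E \<Longrightarrow> {x, y} \<in> E \<Longrightarrow> {u, v} \<noteq> {x, y} \<Longrightarrow>
      open_segment (p u) (p v) \<inter> open_segment (p x) (p y) = {}"
    using assms unfolding planar_straight_line_embedding_def by simp_all
  have empty: "p ` V \<inter> ?T = {}"
    using face by (simp add: empty_face_def)
  have edge: "open_segment (p u) (p v) \<inter> ?T = {}" if "{u, v} \<in> E" for u v
    using face that by (simp add: empty_face_def)
  have "inj_on ?p V \<longleftrightarrow> inj_on p V" by (rule inj_on_cong) (use w in auto)
  moreover have "q \<notin> p ` V" using empty q by blast
  moreover have "?p ` V = p ` V" using w by auto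
  ultimately show "inj_on ?p (insert w V)"
    using inj w by simp
  show "?p ` insert w V \<inter> open_segment (?p u) (?p v) = {}"
    if "{u, v} \<in> E \<union> {{w, a}, {w, b}, {w, c}}" for u v
    using that
  proof (cases rule: insert_vertex_edge_cases)
    case old
    show ?thesis unfolding insert_vertex_image old(2)
      using vertex[OF old(1)] edge[OF old(1)] q by blast
  next
    case (new s)
    have "q \<notin> open_segment q (p s)" by (simp add: open_segment_def)
    thus ?thesis unfolding insert_vertex_image new(3)
      using empty insert_vertex_open_segment[OF new(1)] by blast
  qed
  show "open_segment (?p u) (?p v) \<inter> open_segment (?p x) (?p y) = {}"
    if uv: "{u, v} \<in> E \<union> {{w, a}, {w, b}, {w, c}}"
      and xy: "{x, y} \<in> E \<union> {{w, a}, {w, b}, {w, c}}" and ne: "{u, v} \<noteq> {x, y}" for u v x y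
    using uv
  proof (cases rule: insert_vertex_edge_cases)
    case uv: old
    from xy show ?thesis
    proof (cases rule: insert_vertex_edge_cases)
      case old
      show ?thesis unfolding uv(2) old(2) by (rule cross[OF uv(1) old(1) ne])
    next
      case (new s)
      show ?thesis unfolding uv(2) new(3)
        using edge[OF uv(1)] insert_vertex_open_segment[OF new(1)] by blast
    qed
  next
    case uv: (new s)
    from xy show ?thesis
    proof (cases rule: insert_vertex_edge_cases)
      case old
      show ?thesis unfolding uv(3) old(2)
        using edge[OF old(1)] insert_vertex_open_segment[OF uv(1)] by blast
    next
      case (new t)
      have "s \<noteq> t" using uv new ne by auto
      moreover have "orient q (p a) (p b) \<noteq> 0" "orient q (p b) (p c) \<noteq> 0" "orient q (p c) (p a) \<noteq> 0"
        using q by (auto simp: open_triangle_def orient_rotate)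
      \<comment> \<open>The signs are known only for consecutive corners in cyclic order, so one of
        the two orders of \<open>s\<close> and \<open>t\<close> is used.\<close>
      ultimately have "orient q (p s) (p t) \<noteq> 0 \<or> orient q (p t) (p s) \<noteq> 0"
        using uv(1) new(1) by auto
      thus ?thesis unfolding uv(3) new(3)
        using open_segments_from_point_disjoint by (metis Int_commute)
    qed
  qed
qed

text \<open>Keeps the side \<open>a b\<close>, so that a side crossing the axis is available for the
  next insertion.\<close>

lemma empty_face_insert_vertex_new:
  "empty_face (insert w V) (E \<union> {{w, a}, {w, b}, {w, c}}) (p(w := q)) a b w"
proof -
  let ?p = "p(w := q)" and ?T = "open_triangle (p a) (p b) q"
  note F = face[unfolded empty_face_def]
  have ab: "?p a = p a" "?p b = p b" "?p w = q" using F w by auto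
  have sub: "?T \<subseteq> open_triangle (p a) (p b) (p c)"
    by (rule open_triangle_subdivide[OF q])
  have "q \<notin> ?T" by (rule open_triangle_subdivide(3)[OF q])
  hence "?p ` insert w V \<inter> ?T = {}"
    unfolding insert_vertex_image using F sub by blast
  moreover have "open_segment (?p u) (?p v) \<inter> ?T = {}"
    if "{u, v} \<in> E \<union> {{w, a}, {w, b}, {w, c}}" for u v
    using that
  proof (cases rule: insert_vertex_edge_cases)
    case old
    show ?thesis unfolding old(2) using F old(1) sub by blast
  next
    case (new s)
    show ?thesis unfolding new(3)
      by (rule open_triangle_subdivide(2)[OF q]) (use new(1) in auto)
  qed
  ultimately show ?thesis
    unfolding empty_face_def ab using F q by (auto simp: open_triangle_def)
qed

lemma empty_face_insert_vertex_old:
  assumes "empty_face V E p d e f"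
    and disj: "open_triangle (p a) (p b) (p c) \<inter> open_triangle (p d) (p e) (p f) = {}"
  shows "empty_face (insert w V) (E \<union> {{w, a}, {w, b}, {w, c}}) (p(w := q)) d e f"
proof -
  let ?p = "p(w := q)" and ?T = "open_triangle (p d) (p e) (p f)"
  note F = assms(1)[unfolded empty_face_def]
  have def: "?p d = p d" "?p e = p e" "?p f = p f" using F w by auto
  have "?p ` insert w V \<inter> ?T = {}"
    unfolding insert_vertex_image using F disj q by blast
  moreover have "open_segment (?p u) (?p v) \<inter> ?T = {}"
    if "{u, v} \<in> E \<union> {{w, a}, {w, b}, {w, c}}" for u v
    using that
  proof (cases rule: insert_vertex_edge_cases)
    case old
    show ?thesis unfolding old(2) using F old(1) by blast
  next
    case (new s)
    show ?thesis unfolding new(3) using insert_vertex_open_segment[OF new(1)] disj by blast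
  qed
  ultimately show ?thesis
    unfolding empty_face_def def using F by auto
qed

end

section \<open>Verifying a drawing with integer coordinates\<close>

fun int_orient :: "int \<times> int \<Rightarrow> int \<times> int \<Rightarrow> int \<times> int \<Rightarrow> int" where
  "int_orient (x\<^sub>1, y\<^sub>1) (x\<^sub>2, y\<^sub>2) (x\<^sub>3, y\<^sub>3) = (x\<^sub>2 - x\<^sub>1) * (y\<^sub>3 - y\<^sub>1) - (y\<^sub>2 - y\<^sub>1) * (x\<^sub>3 - x\<^sub>1)"

definition int_point :: "(int \<times> int) list \<Rightarrow> nat \<Rightarrow> real^2" where
  "int_point P v = vector [of_int (fst (P ! v)), of_int (snd (P ! v))]"

lemma orient_int_point:
  "orient (int_point P u) (int_point P v) (int_point P w) = of_int (int_orient (P ! u) (P ! v) (P ! w))"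
  by (cases "P ! u"; cases "P ! v"; cases "P ! w") (simp add: orient_def int_point_def)

definition edge_set :: "(nat \<times> nat) list \<Rightarrow> nat set set" where
  "edge_set L = (\<lambda>(u, v). {u, v}) ` set L"

text \<open>The endpoints of \<open>f\<close> lie weakly on one side of the line through
  \<open>e\<close>, not both on it. Weak inequalities admit edges with a common endpoint.\<close>

definition separates :: "(int \<times> int) list \<Rightarrow> nat \<times> nat \<Rightarrow> nat \<times> nat \<Rightarrow> bool" where
  "separates P e f \<longleftrightarrow>
     (let s = int_orient (P ! fst e) (P ! snd e) (P ! fst f);
          t = int_orient (P ! fst e) (P ! snd e) (P ! snd f)
      in s \<ge> 0 \<and> t \<ge> 0 \<and> s + t > 0 \<or> s \<le> 0 \<and> t \<le> 0 \<and> s + t < 0)"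

text \<open>The vertex test is stricter than planarity demands: no third vertex may lie on the whole
  line through an edge, which needs only one sign per triple.\<close>

definition drawing_ok :: "(int \<times> int) list \<Rightarrow> (nat \<times> nat) list \<Rightarrow> bool" where
  "drawing_ok P L \<longleftrightarrow> distinct P \<and>
     list_all (\<lambda>(u, v). list_all (\<lambda>w. w = u \<or> w = v \<or> int_orient (P ! u) (P ! v) (P ! w) \<noteq> 0)
       [0..<length P]) L \<and>
     list_all (\<lambda>e. list_all (\<lambda>f. e = f \<or> separates P e f \<or> separates P f e) L) L"

text \<open>A segment disjoint from an open triangle is separated from it by its own line or by the line
  through a side of the triangle.\<close>

definition face_ok :: "(int \<times> int) list \<Rightarrow> (nat \<times> nat) list \<Rightarrow> nat \<Rightarrow> nat \<Rightarrow> nat \<Rightarrow> bool" where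
  "face_ok P L a b c \<longleftrightarrow> a < length P \<and> b < length P \<and> c < length P \<and>
     int_orient (P ! a) (P ! b) (P ! c) > 0 \<and>
     list_all (\<lambda>w. int_orient (P ! a) (P ! b) w \<le> 0 \<or> int_orient (P ! b) (P ! c) w \<le> 0 \<or>
       int_orient (P ! c) (P ! a) w \<le> 0) P \<and>
     list_all (\<lambda>(u, v).
       list_ex (\<lambda>(x, y). int_orient (P ! x) (P ! y) (P ! u) \<le> 0 \<and> int_orient (P ! x) (P ! y) (P ! v) \<le> 0)
         [(a, b), (b, c), (c, a)] \<or>
       (let s = map (\<lambda>x. int_orient (P ! u) (P ! v) (P ! x)) [a, b, c]
        in list_all (\<lambda>x. x \<ge> 0) s \<and> sum_list s > 0 \<or> list_all (\<lambda>x. x \<le> 0) s \<and> sum_list s < 0)) L"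

lemma edge_set_cases:
  assumes "{u, v} \<in> edge_set L"
  obtains u' v' where "(u', v') \<in> set L" "{u, v} = {u', v'}"
    "open_segment (p u) (p v) = open_segment (p u') (p v')"
  using assms that
  by (auto simp: edge_set_def doubleton_eq_iff open_segment_commute)

lemma separates_disjoint:
  assumes "separates P e f"
  shows "open_segment (int_point P (fst e)) (int_point P (snd e)) \<inter>
    open_segment (int_point P (fst f)) (int_point P (snd f)) = {}"
proof (rule equals0I)
  let ?a = "int_point P (fst e)" and ?b = "int_point P (snd e)"
  let ?c = "int_point P (fst f)" and ?d = "int_point P (snd f)"
  fix x assume "x \<in> open_segment ?a ?b \<inter> open_segment ?c ?d"
  hence "x \<in> open_segment ?a ?b" "x \<in> open_segment ?c ?d" by auto
  then obtain k l where l: "0 < l" "l < 1"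
    and k: "\<And>a b. orient a b x = (1 - k) * orient a b ?a + k * orient a b ?b"
    and *: "\<And>a b. orient a b x = (1 - l) * orient a b ?c + l * orient a b ?d"
    by (metis open_segment_orient)
  define s t where "s = orient ?a ?b ?c" and "t = orient ?a ?b ?d"
  \<comment> \<open>A common point lies on the line \<open>?a ?b\<close>, where the orientation
    vanishes, yet it is a proper convex combination of \<open>?c\<close> and
    \<open>?d\<close>.\<close>
  have 0: "(1 - l) * s + l * t = 0"
    using k[of ?a ?b] *[of ?a ?b] by (simp add: s_def t_def)
  have "s \<ge> 0 \<and> t \<ge> 0 \<and> s + t > 0 \<or> s \<le> 0 \<and> t \<le> 0 \<and> s + t < 0"
    using assms unfolding separates_def s_def t_def orient_int_point Let_def
    by (simp flip: of_int_add)
  thus False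
  proof (elim disjE conjE)
    assume "s \<ge> 0" "t \<ge> 0" "s + t > 0"
    hence "s > 0 \<or> t > 0" by linarith
    with l \<open>s \<ge> 0\<close> \<open>t \<ge> 0\<close> have "(1 - l) * s + l * t > 0"
      by (auto intro: add_pos_nonneg add_nonneg_pos)
    with 0 show False by simp
  next
    assume "s \<le> 0" "t \<le> 0" "s + t < 0"
    hence "s < 0 \<or> t < 0" by linarith
    with l \<open>s \<le> 0\<close> \<open>t \<le> 0\<close> have "(1 - l) * s + l * t < 0"
      by (auto intro: add_neg_nonpos add_nonpos_neg simp: mult_pos_neg mult_nonneg_nonpos)
    with 0 show False by simp
  qed
qed

lemma planar_if_drawing_ok:
  assumes "drawing_ok P L"
  shows "planar_straight_line_embedding {..<length P} (edge_set L) (int_point P)"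
  unfolding planar_straight_line_embedding_def
proof (intro conjI allI impI)
  let ?p = "int_point P"
  have coord: "?p v $ 1 = of_int (fst (P ! v))" "?p v $ 2 = of_int (snd (P ! v))" for v
    by (simp_all add: int_point_def)
  show "inj_on ?p {..<length P}"
  proof (rule inj_onI)
    fix u v assume uv: "u \<in> {..<length P}" "v \<in> {..<length P}" "?p u = ?p v"
    hence "P ! u = P ! v" using coord[of u] coord[of v] by (simp add: prod_eq_iff)
    thus "u = v" using uv assms by (simp add: drawing_ok_def nth_eq_iff_index_eq)
  qed
  show "?p ` {..<length P} \<inter> open_segment (?p u) (?p v) = {}" if "{u, v} \<in> edge_set L" for u v
    using that
  proof (rule edge_set_cases[where p = ?p])
    fix u' v' assume uv: "(u', v') \<in> set L"
      and seg: "open_segment (?p u) (?p v) = open_segment (?p u') (?p v')"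
    have "?p w \<notin> open_segment (?p u') (?p v')" if "w < length P" for w
    proof
      assume w: "?p w \<in> open_segment (?p u') (?p v')"
      hence "w \<noteq> u'" "w \<noteq> v'" by (auto simp: open_segment_def)
      hence "int_orient (P ! u') (P ! v') (P ! w) \<noteq> 0"
        using assms uv that by (fastforce simp: drawing_ok_def list_all_iff)
      moreover have "orient (?p u') (?p v') (?p w) = 0"
        using w by (elim open_segment_orient) simp
      ultimately show False by (simp add: orient_int_point)
    qed
    thus ?thesis unfolding seg by auto
  qed
  show "open_segment (?p u) (?p v) \<inter> open_segment (?p x) (?p y) = {}"
    if uv0: "{u, v} \<in> edge_set L" and xy0: "{x, y} \<in> edge_set L" and ne: "{u, v} \<noteq> {x, y}" for u v x y
  proof -
    obtain u' v' where uv: "(u', v') \<in> set L" "{u, v} = {u', v'}"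
      "open_segment (?p u) (?p v) = open_segment (?p u') (?p v')"
      using edge_set_cases[OF uv0] by metis
    obtain x' y' where xy: "(x', y') \<in> set L" "{x, y} = {x', y'}"
      "open_segment (?p x) (?p y) = open_segment (?p x') (?p y')"
      using edge_set_cases[OF xy0] by metis
    have "(u', v') \<noteq> (x', y')" using uv(2) xy(2) ne by auto
    hence "separates P (u', v') (x', y') \<or> separates P (x', y') (u', v')"
      using assms uv(1) xy(1) by (fastforce simp: drawing_ok_def list_all_iff)
    thus ?thesis unfolding uv(3) xy(3) using separates_disjoint by fastforce
  qed
qed

lemma empty_face_if_face_ok:
  assumes "face_ok P L a b c"
  shows "empty_face {..<length P} (edge_set L) (int_point P) a b c"
proof -
  let ?p = "int_point P"
  let ?T = "open_triangle (?p a) (?p b) (?p c)"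
  have *: "{a, b, c} \<subseteq> {..<length P}" "0 < orient (?p a) (?p b) (?p c)"
    using assms by (auto simp: face_ok_def orient_int_point)
  have "?p w \<notin> ?T" if "w < length P" for w
    using assms nth_mem[OF that]
    by (fastforce simp: face_ok_def list_all_iff open_triangle_def orient_int_point)
  moreover have "open_segment (?p u) (?p v) \<inter> ?T = {}" if "{u, v} \<in> edge_set L" for u v
    using that
  proof (rule edge_set_cases[where p = ?p])
    fix u' v' assume uv: "(u', v') \<in> set L"
      and seg: "open_segment (?p u) (?p v) = open_segment (?p u') (?p v')"
    show ?thesis unfolding seg
    proof (rule equals0I)
      fix x assume "x \<in> open_segment (?p u') (?p v') \<inter> ?T"
      hence x: "x \<in> open_segment (?p u') (?p v')"
        and T: "0 < orient (?p a) (?p b) x" "0 < orient (?p b) (?p c) x" "0 < orient (?p c) (?p a) x"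
        by (auto simp: open_triangle_def)
      from x obtain t where t: "0 < t" "t < 1"
        and xt: "\<And>a b. orient a b x = (1 - t) * orient a b (?p u') + t * orient a b (?p v')"
        by (metis open_segment_orient)
      have not_outside: "\<not> (orient r s (?p u') \<le> 0 \<and> orient r s (?p v') \<le> 0)"
        if "0 < orient r s x" for r s
      proof
        assume "orient r s (?p u') \<le> 0 \<and> orient r s (?p v') \<le> 0"
        hence "(1 - t) * orient r s (?p u') + t * orient r s (?p v') \<le> 0"
          using t by (intro add_nonpos_nonpos mult_nonneg_nonpos) auto
        thus False using that xt by simp
      qed
      define A B C where "A = orient (?p u') (?p v') (?p a)"
        and "B = orient (?p u') (?p v') (?p b)" and "C = orient (?p u') (?p v') (?p c)"
      have "0 = orient (?p u') (?p v') x * orient (?p a) (?p b) (?p c)"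
        using xt[of "?p u'" "?p v'"] by simp
      \<comment> \<open>Writes \<open>x\<close> in barycentric coordinates of the triangle. Since
        \<open>x\<close> lies on the line of the edge, a positive combination of \<open>A\<close>,
        \<open>B\<close>, \<open>C\<close> vanishes, which excludes weakly equal signs that are not
        all zero.\<close>
      also have "\<dots> = orient (?p b) (?p c) x * A + orient (?p c) (?p a) x * B + orient (?p a) (?p b) x * C"
        by (simp add: A_def B_def C_def orient_def algebra_simps)
      finally have bary: "orient (?p b) (?p c) x * A + orient (?p c) (?p a) x * B + orient (?p a) (?p b) x * C = 0"
        by simp
      have pos: "r * A' + s * B' + t * C' > 0"
        if "0 < r" "0 < s" "0 < t" "A' \<ge> 0" "B' \<ge> 0" "C' \<ge> 0" "A' + B' + C' > 0"
        for r s t A' B' C' :: real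
      proof -
        have "A' > 0 \<or> B' > 0 \<or> C' > 0" using that by linarith
        hence "r * A' > 0 \<or> s * B' > 0 \<or> t * C' > 0" using that by auto
        moreover have "r * A' \<ge> 0" "s * B' \<ge> 0" "t * C' \<ge> 0" using that by auto
        ultimately show ?thesis by linarith
      qed
      have "\<not> (A \<ge> 0 \<and> B \<ge> 0 \<and> C \<ge> 0 \<and> A + B + C > 0)"
        using pos[OF T(2,3,1), of A B C] bary by auto
      moreover have "\<not> (A \<le> 0 \<and> B \<le> 0 \<and> C \<le> 0 \<and> A + B + C < 0)"
        using pos[OF T(2,3,1), of "-A" "-B" "-C"] bary by auto
      moreover note not_outside[OF T(1)] not_outside[OF T(2)] not_outside[OF T(3)]
      moreover have "list_ex (\<lambda>(x, y). int_orient (P ! x) (P ! y) (P ! u') \<le> 0 \<and>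
            int_orient (P ! x) (P ! y) (P ! v') \<le> 0) [(a, b), (b, c), (c, a)] \<or>
          (let s = map (\<lambda>x. int_orient (P ! u') (P ! v') (P ! x)) [a, b, c]
           in list_all (\<lambda>x. x \<ge> 0) s \<and> sum_list s > 0 \<or> list_all (\<lambda>x. x \<le> 0) s \<and> sum_list s < 0)"
        using assms uv unfolding face_ok_def by (simp only: list_all_iff) blast
      ultimately show False
        unfolding A_def B_def C_def orient_int_point by (auto simp: Let_def simp flip: of_int_add)
    qed
  qed
  ultimately show ?thesis using * by (auto simp: empty_face_def)
qed

section \<open>A base drawing with 12 vertices and 57 edges\<close>

text \<open>The drawing was found by a SAT search for two \<open>x\<close>-monotone triangulations sharing as few
  edges as possible. The second list gives the pairs \<open>(z, x)\<close>, in the order in which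
  \<open>coord_proj ZX\<close> returns them.\<close>

definition base_xy :: "(int \<times> int) list" where
  "base_xy =
     [(-6, 7), (-5, 15), (-4, 25), (-3, 11), (-2, 46), (-1, 8), (0, 9), (1, 6), (2, 0),
     (3, 96), (4, 0), (5, -3)]"

definition base_zx :: "(int \<times> int) list" where
  "base_zx =
     [(0, -6), (0, -5), (2, -4), (30, -3), (26, -2), (2, -1), (17, 0), (4, 1), (9, 2), (3, 3),
     (3, 4), (1, 5)]"

definition base_edges_xy :: "(nat \<times> nat) list" where
  "base_edges_xy =
     [(0, 1), (0, 4), (0, 8), (0, 9), (0, 11), (1, 2), (1, 3), (1, 4), (1, 5), (1, 6), (1, 7),
     (1, 8), (2, 4), (2, 6), (2, 10), (2, 11), (3, 5), (3, 8), (4, 9), (4, 11), (5, 7), (5, 8),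
     (5, 11), (6, 7), (6, 10), (6, 11), (7, 11), (8, 11), (9, 11), (10, 11)]"

text \<open>The first drawing has 30 = 3 * 12 - 6 edges, the planar maximum; this one has 27, three
  fewer.\<close>

definition base_edges_zx :: "(nat \<times> nat) list" where
  "base_edges_zx =
     [(0, 2), (0, 3), (0, 5), (0, 10), (1, 10), (1, 11), (2, 3), (2, 5), (2, 7), (2, 9),
     (3, 4), (3, 6), (3, 7), (3, 9), (3, 10), (3, 11), (4, 6), (4, 8), (4, 10), (5, 9),
     (5, 10), (6, 8), (6, 9), (7, 9), (8, 9), (8, 10), (9, 10)]"

lemma base_drawing_ok: "drawing_ok base_xy base_edges_xy" "drawing_ok base_zx base_edges_zx"
  by code_simp+

text \<open>In each triple the first two corners have \<open>x\<close> of opposite signs, so new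
  vertices can be placed at \<open>x = 0\<close>.\<close>

lemma base_face_ok:
  "face_ok base_xy base_edges_xy 0 11 8"
  "face_ok base_zx base_edges_zx 2 9 5"
  "face_ok base_zx base_edges_zx 3 10 4"
  by code_simp+

text \<open>Increasing pairs correspond one-to-one to edges. Distinctness of the concatenation
  therefore yields both edge counts and the disjointness of the two edge sets.\<close>

lemma base_edges:
  "list_all (\<lambda>(u, v). u < v \<and> v < 12) (base_edges_xy @ base_edges_zx)"
  "distinct (base_edges_xy @ base_edges_zx)"
  "length base_edges_xy + length base_edges_zx = 57"
  by code_simp+

lemma base_faces_disjoint:
  "open_triangle (int_point base_zx 2) (int_point base_zx 9) (int_point base_zx 5) \<inter>
   open_triangle (int_point base_zx 3) (int_point base_zx 10) (int_point base_zx 4) = {}"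
proof (rule equals0I)
  let ?p = "int_point base_zx"
  fix x assume "x \<in> open_triangle (?p 2) (?p 9) (?p 5) \<inter> open_triangle (?p 3) (?p 10) (?p 4)"
  hence "0 < orient (?p 2) (?p 9) x" "0 < orient (?p 9) (?p 5) x" "0 < orient (?p 5) (?p 2) x"
    "0 < orient (?p 10) (?p 4) x"
    by (simp_all add: open_triangle_def)
  \<comment> \<open>The line through 10 and 4 separates: all three corners 2, 9, 5 lie strictly on
    its negative side.\<close>
  thus False
    by (simp add: orient_def int_point_def base_zx_def)
qed

section \<open>From lists of pairs to sets of edges\<close>

lemma increasing_pairs_inj:
  fixes L :: "(nat \<times> nat) list"
  assumes "list_all (\<lambda>(u, v). u < v \<and> v < n) L"
  shows "inj_on (\<lambda>(u, v). {u, v}) (set L)"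
proof (rule inj_onI, clarify)
  fix u v x y assume "(u, v) \<in> set L" "(x, y) \<in> set L" and eq: "{u, v} = {x, y}"
  hence "u < v" "x < y" using assms unfolding list_all_iff by blast+
  with eq show "u = x \<and> v = y" by (auto simp: doubleton_eq_iff)
qed

lemma edge_set_card:
  assumes "list_all (\<lambda>(u, v). u < v \<and> v < n) L" "distinct L"
  shows "card (edge_set L) = length L"
  using increasing_pairs_inj[OF assms(1)] assms(2)
  by (simp add: edge_set_def card_image distinct_card)

lemma edge_set_elements:
  assumes "list_all (\<lambda>(u, v). u < v \<and> v < n) L" "x \<in> edge_set L"
  shows "x \<subseteq> {..<n} \<and> card x = 2"
proof -
  obtain u v where x: "x = {u, v}" and "(u, v) \<in> set L"
    using assms(2) by (auto simp: edge_set_def)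
  hence "u < v" "v < n" using assms(1) unfolding list_all_iff by blast+
  thus ?thesis by (simp add: x)
qed

lemma edge_set_disjoint:
  assumes "list_all (\<lambda>(u, v). u < v \<and> v < n) (L @ M)" "distinct (L @ M)"
  shows "edge_set L \<inter> edge_set M = {}"
proof -
  have "edge_set L \<inter> edge_set M = (\<lambda>(u, v). {u, v}) ` (set L \<inter> set M)"
    unfolding edge_set_def
    by (rule inj_on_image_Int[symmetric, OF increasing_pairs_inj[OF assms(1)]]) auto
  thus ?thesis using assms(2) by simp
qed

section \<open>Adding vertices\<close>

text \<open>The induction invariant. The next vertex goes into \<open>a b c\<close> and
  \<open>d e h\<close>; the face \<open>d' e' h'\<close> waits for the step after. The shared
  \<open>x\<close> is component 1 of \<open>f\<close> and component 2 of \<open>g\<close>, as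
  \<open>ZX\<close> returns \<open>(z, x)\<close>. The second part of
  \<open>corners_disjoint\<close> omits \<open>c\<close>, since a fresh vertex has replaced it by
  the time \<open>d' e' h'\<close> is used.\<close>

locale extendable =
  fixes n :: nat and E F :: "nat set set" and f g :: "nat \<Rightarrow> real^2"
    and a b c d e h d' e' h' :: nat
  assumes edges_E: "x \<in> E \<Longrightarrow> x \<subseteq> {..<n} \<and> card x = 2"
    and edges_F: "x \<in> F \<Longrightarrow> x \<subseteq> {..<n} \<and> card x = 2"
    and edges_disjoint: "E \<inter> F = {}"
    and edges_card: "card E + card F + 15 = 6 * n"
    and common_coordinate: "v < n \<Longrightarrow> f v $ 1 = g v $ 2"
    and planar_E: "planar_straight_line_embedding {..<n} E f"
    and planar_F: "planar_straight_line_embedding {..<n} F g"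
    and face_E: "empty_face {..<n} E f a b c"
    and face_F: "empty_face {..<n} F g d e h"
    and face_F': "empty_face {..<n} F g d' e' h'"
    and across_axis: "f a $ 1 < 0" "0 < f b $ 1" "g d $ 2 < 0" "0 < g e $ 2" "g d' $ 2 < 0" "0 < g e' $ 2"
    and faces_F_disjoint: "open_triangle (g d) (g e) (g h) \<inter> open_triangle (g d') (g e') (g h') = {}"
    and corners_disjoint: "{a, b, c} \<inter> {d, e, h} = {}" "{a, b} \<inter> {d', e', h'} = {}"

lemma extendable_base:
  "extendable 12 (edge_set base_edges_xy) (edge_set base_edges_zx) (int_point base_xy)
     (int_point base_zx) 0 11 8 2 9 5 3 10 4"
proof -
  have len: "length base_xy = 12" "length base_zx = 12"
    by (simp_all add: base_xy_def base_zx_def)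
  have x: "\<forall>v < 12. int_point base_xy v $ 1 = int_point base_zx v $ 2"
    by (auto simp: int_point_def base_xy_def base_zx_def less_Suc_eq numeral_eq_Suc)
  have sign: "int_point base_xy 0 $ 1 < 0" "0 < int_point base_xy 11 $ 1"
    "int_point base_zx 2 $ 2 < 0" "0 < int_point base_zx 9 $ 2"
    "int_point base_zx 3 $ 2 < 0" "0 < int_point base_zx 10 $ 2"
    by (simp_all add: int_point_def base_xy_def base_zx_def)
  have ok: "list_all (\<lambda>(u, v). u < v \<and> v < 12) base_edges_xy" "distinct base_edges_xy"
    "list_all (\<lambda>(u, v). u < v \<and> v < 12) base_edges_zx" "distinct base_edges_zx"
    using base_edges by auto
  note planar = base_drawing_ok[THEN planar_if_drawing_ok]
  note faces = base_face_ok[THEN empty_face_if_face_ok]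
  show ?thesis
  proof
    show "card (edge_set base_edges_xy) + card (edge_set base_edges_zx) + 15 = 6 * 12"
      using base_edges(3) edge_set_card[OF ok(1,2)] edge_set_card[OF ok(3,4)] by simp
    show "edge_set base_edges_xy \<inter> edge_set base_edges_zx = {}"
      by (rule edge_set_disjoint[OF base_edges(1,2)])
  qed (use edge_set_elements[OF ok(1)] edge_set_elements[OF ok(3)] planar[unfolded len]
      faces[unfolded len] base_faces_disjoint x sign in simp_all)
qed

lemma empty_face_distinct:
  assumes "empty_face V E p a b c"
  shows "a \<noteq> b" "b \<noteq> c" "c \<noteq> a"
  using assms by (auto simp: empty_face_def)

lemma card_insert_star:
  fixes n a b c :: nat
  assumes "\<forall>x \<in> E. x \<subseteq> {..<n}" "a \<noteq> b" "b \<noteq> c" "c \<noteq> a"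
  shows "card (E \<union> {{n, a}, {n, b}, {n, c}}) = card E + 3"
proof -
  have "finite E" by (rule finite_subset[of _ "Pow {..<n}"]) (use assms(1) in auto)
  moreover have "E \<inter> {{n, a}, {n, b}, {n, c}} = {}" using assms(1) by auto
  moreover have "card {{n, a}, {n, b}, {n, c}} = 3"
    using assms(2-4) by (auto simp: card_insert_if doubleton_eq_iff)
  ultimately show ?thesis
    using card_Un_disjoint[of E "{{n, a}, {n, b}, {n, c}}"] by simp
qed

text \<open>In the first drawing every new vertex becomes adjacent to its predecessor. Alternating
  between two faces of the second drawing makes it adjacent there to the vertex before the
  predecessor, so the two edge sets stay disjoint.\<close>

lemma (in extendable) extendable_step:
  "\<exists>E F f g. extendable (Suc n) E F f g a b n d' e' h' d e n"
proof -
  have lt: "a < n" "b < n" "c < n" "d < n" "e < n" "h < n" "d' < n" "e' < n" "h' < n"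
    using face_E face_F face_F' by (simp_all add: empty_face_def)
  obtain q where q: "q \<in> open_triangle (f a) (f b) (f c)" "q $ 1 = 0"
    using open_triangle_meets_axis[of "f a" "f b" "f c" 1] across_axis face_E
    unfolding empty_face_def by blast
  obtain r where r: "r \<in> open_triangle (g d) (g e) (g h)" "r $ 2 = 0"
    using open_triangle_meets_axis[of "g d" "g e" "g h" 2] across_axis face_F
    unfolding empty_face_def by blast
  let ?E = "E \<union> {{n, a}, {n, b}, {n, c}}" and ?F = "F \<union> {{n, d}, {n, e}, {n, h}}"
  let ?f = "f(n := q)" and ?g = "g(n := r)"
  have n: "n \<notin> {..<n}" by simp
  note insE = edges_E[THEN conjunct1] face_E n q(1)
    and insF = edges_F[THEN conjunct1] face_F n r(1)
  have new: "{n, s} \<notin> E" "{n, s} \<notin> F" for s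
    using edges_E edges_F by blast+
  have "extendable (Suc n) ?E ?F ?f ?g a b n d' e' h' d e n"
  proof
    show "planar_straight_line_embedding {..<Suc n} ?E ?f" "empty_face {..<Suc n} ?E ?f a b n"
      using planar_insert_vertex[OF insE planar_E] empty_face_insert_vertex_new[OF insE]
      by (simp_all only: lessThan_Suc)
    show "planar_straight_line_embedding {..<Suc n} ?F ?g" "empty_face {..<Suc n} ?F ?g d e n"
      "empty_face {..<Suc n} ?F ?g d' e' h'"
      using planar_insert_vertex[OF insF planar_F] empty_face_insert_vertex_new[OF insF]
        empty_face_insert_vertex_old[OF insF face_F' faces_F_disjoint]
      by (simp_all only: lessThan_Suc)
    \<comment> \<open>The face \<open>d e n\<close> lies inside the former face
      \<open>d e h\<close>.\<close>
    show "open_triangle (?g d') (?g e') (?g h') \<inter> open_triangle (?g d) (?g e) (?g n) = {}"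
      using open_triangle_subdivide(1)[OF r(1)] faces_F_disjoint lt by auto
    show "card ?E + card ?F + 15 = 6 * Suc n"
      using card_insert_star[OF _ empty_face_distinct[OF face_E], of E n]
        card_insert_star[OF _ empty_face_distinct[OF face_F], of F n] edges_E edges_F edges_card
      by simp
    show "x \<subseteq> {..<Suc n} \<and> card x = 2" if "x \<in> ?E" for x
      using that edges_E[of x] lt by (fastforce simp: card_insert_if)
    show "x \<subseteq> {..<Suc n} \<and> card x = 2" if "x \<in> ?F" for x
      using that edges_F[of x] lt by (fastforce simp: card_insert_if)
    show "?E \<inter> ?F = {}"
    proof -
      \<comment> \<open>All new edges contain \<open>n\<close>, so they avoid the old ones; the two
        stars at \<open>n\<close> share no edge because their corners differ.\<close>
      have "{n, s} \<noteq> {n, t}" if "s \<in> {a, b, c}" "t \<in> {d, e, h}" for s t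
        using that corners_disjoint lt by (auto simp: doubleton_eq_iff)
      thus ?thesis using new edges_disjoint by blast
    qed
    show "?f v $ 1 = ?g v $ 2" if "v < Suc n" for v
      using that common_coordinate q r by (auto simp: less_Suc_eq)
    show "{a, b, n} \<inter> {d', e', h'} = {}" "{a, b} \<inter> {d, e, n} = {}"
      using corners_disjoint lt by auto
  qed (use across_axis lt in auto)
  thus ?thesis by blast
qed

lemma extendable_exists:
  assumes "n \<ge> 12"
  shows "\<exists>E F f g a b c d e h d' e' h'. extendable n E F f g a b c d e h d' e' h'"
  using assms
proof (induction n rule: dec_induct)
  case base
  show ?case using extendable_base by blast
next
  case (step n)
  then obtain E F f g a b c d e h d' e' h' where "extendable n E F f g a b c d e h d' e' h'"
    by blast
  from extendable.extendable_step[OF this] show ?case by blast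
qed

section \<open>Lifting the two drawings to space\<close>

theorem theorem2:
  fixes n :: nat
  assumes "n \<ge> 14"
  shows "\<exists>(V :: nat set) E E\<^sub>1 E\<^sub>2 (\<phi> :: nat \<Rightarrow> real^3) P\<^sub>1 P\<^sub>2.
           simple_graph V E \<and> card V = n \<and> card E = 6 * n - 15 \<and>
           inj_on \<phi> V \<and> P\<^sub>1 \<noteq> P\<^sub>2 \<and>
           E = E\<^sub>1 \<union> E\<^sub>2 \<and> E\<^sub>1 \<inter> E\<^sub>2 = {} \<and>
           planar_straight_line_embedding V E\<^sub>1 (coord_proj P\<^sub>1 \<circ> \<phi>) \<and>
           planar_straight_line_embedding V E\<^sub>2 (coord_proj P\<^sub>2 \<circ> \<phi>)"
proof -
  have "n \<ge> 12" using assms by simp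
  from extendable_exists[OF this]
  obtain E F f g a b c d e h d' e' h' where "extendable n E F f g a b c d e h d' e' h'"
    by blast
  then interpret extendable n E F f g a b c d e h d' e' h' .
  \<comment> \<open>\<open>f\<close> supplies \<open>x\<close> and \<open>y\<close>,
    \<open>g\<close> supplies \<open>z\<close>; the \<open>x\<close> required by the
    \<open>ZX\<close> projection is then correct by \<open>common_coordinate\<close>, for vertices
    below \<open>n\<close>.\<close>
  define \<phi> :: "nat \<Rightarrow> real^3" where "\<phi> v = vector [f v $ 1, f v $ 2, g v $ 1]" for v
  have f: "(coord_proj XY \<circ> \<phi>) v = f v" for v
    by (simp add: \<phi>_def vec_eq_iff forall_2)
  have g: "(coord_proj ZX \<circ> \<phi>) v = g v" if "v < n" for v
    using common_coordinate that by (simp add: \<phi>_def vec_eq_iff forall_2)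
  have "inj_on (coord_proj XY \<circ> \<phi>) {..<n}"
    using planar_E unfolding planar_straight_line_embedding_def inj_on_def f by blast
  hence inj: "inj_on \<phi> {..<n}" by (rule inj_on_imageI2)
  have fin: "finite E" "finite F"
    by (rule finite_subset[of _ "Pow {..<n}"]; use edges_E edges_F in blast)+
  have "planar_straight_line_embedding {..<n} E (coord_proj XY \<circ> \<phi>)"
    using planar_E f by (metis ext)
  moreover have "planar_straight_line_embedding {..<n} F (coord_proj ZX \<circ> \<phi>)"
  proof -
    \<comment> \<open>The projection agrees with \<open>g\<close> only below \<open>n\<close>, so
      the endpoints of edges must be bounded before rewriting.\<close>
    have "u < n \<and> v < n" if "{u, v} \<in> F" for u v using edges_F that by blast
    thus ?thesis
      using planar_F g unfolding planar_straight_line_embedding_def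
      by (auto simp: inj_on_def image_def simp del: comp_apply)
  qed
  moreover have "card (E \<union> F) = 6 * n - 15"
    using edges_card edges_disjoint fin by (simp add: card_Un_disjoint)
  moreover have "simple_graph {..<n} (E \<union> F)"
    using edges_E edges_F by (auto simp: simple_graph_def)
  ultimately show ?thesis
    using inj edges_disjoint
    by (intro exI[of _ "{..<n}"] exI[of _ "E \<union> F"] exI[of _ E] exI[of _ F] exI[of _ \<phi>]
        exI[of _ XY] exI[of _ ZX]) simp
qed

end
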